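(* Let $d\in\mathbb{N}$, $m>0$, $T>0$, $\boldsymbol{\mu}_0,\boldsymbol{\mu}_\star\in\mathbb{R}^d$, $\sigma_0,\sigma_\star>0$, let $$\rho_0(x):=\frac{1}{(2\pi\sigma_0^2)^{d/2}}\exp\Big(-\frac{|x-\boldsymbol{\mu}_0|^2}{2\sigma_0^2}\Big),\qquad x\in\mathbb{R}^d,$$ and let $\mu_\star:=\mathcal{N}(\boldsymbol{\mu}_\star,\sigma_\star^2I_d)$. Assume that $$\sigma_\star\ge\frac{T}{2m\sigma_0},$$ and let the affine map $X_\star\colon\mathbb{R}^d\to\mathbb{R}^d$ be defined by $$X_\star(x):=\boldsymbol{\mu}_\star+\frac{\sigma_\star}{\sigma_0}(x-\boldsymbol{\mu}_0),\qquad x\in\mathbb{R}^d.$$ Then, for either of the quadratic initial phase functions $$\theta_{0,\star}^{\pm}(x):=\frac{m a_{0,\star}^{\pm}}{2\sigma_0}|x-\boldsymbol{\mu}_0|^2+m\,\mathbf{u}_{0,\star}\cdot(x-\boldsymbol{\mu}_0)+c_0,\qquad x\in\mathbb{R}^d,$$ with $\mathbf{u}_{0,\star}:=\frac1T(\boldsymbol{\mu}_\star-\boldsymbol{\mu}_0)$, $a_{0,\star}^{\pm}:=\frac1T\big(-\sigma_0\pm(\sigma_\star^2-\frac{T^2}{4m^2\sigma_0^2})^{1/2}\big)$ and arbitrary $c_0\in\mathbb{R}$, the terminal-time transport map of the characteristic flow $X^{\theta_{0,\star}^{\pm}}$ satisfies $$X^{\theta_{0,\star}^{\pm}}(T;x)=X_\star(x)\quad\text{for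 every }x\in\mathbb{R}^d,$$ and if $X_0\colon\Xi\to\mathbb{R}^d$ is a random variable on a probability space $(\Xi,\mathcal{F},\mathbb{P})$ satisfying $[X_0]_{\#}\mathbb{P}=\rho_0\,\mathrm{d}x$, then $$[X_\star(X_0)]_{\#}\mathbb{P}=\mu_\star\quad\text{in }\mathcal{P}(\mathbb{R}^d).$$
   Context: For a quadratic initial phase function $\theta_0(x)=\frac{m a_0}{2\sigma_0}|x-\boldsymbol{\mu}_0|^2+m\,\mathbf{u}_0\cdot(x-\boldsymbol{\mu}_0)+c_0$ with $a_0,c_0\in\mathbb{R}$, $\mathbf{u}_0\in\mathbb{R}^d$, $X^{\theta_0}\colon[0,T]\times\mathbb{R}^d\to\mathbb{R}^d$ denotes the characteristic flow of the Gaussian solution $(\rho^{\theta_0},\theta^{\theta_0})$ of the free Madelung problem (units $\hbar=1$) $$\partial_t\rho+\tfrac1m\operatorname{div}(\rho\nabla\theta)=0,\qquad \partial_t\theta+\tfrac{1}{2m}|\nabla\theta|^2-\tfrac{1}{2m}\tfrac{\Delta\sqrt\rho}{\sqrt\rho}=0\quad\text{in }\mathbb{R}^d\times(0,T),\qquad \rho(\cdot,0)=\rho_0,\ \theta(\cdot,0)=\theta_0,$$ namely of $$\rho^{\theta_0}(x,t)=\frac{1}{(2\pi\sigma(t)^2)^{d/2}}\exp\Big(-\frac{|x-\boldsymbol{\mu}(t)|^2}{2\sigma(t)^2}\Big),\qquad \theta^{\theta_0}(x,t)=\frac{m\dot\sigma(t)}{2\sigma(t)}|x-\boldsymbol{\mu}(t)|^2+m\,\mathbf{u}_0\cdot(x-\boldsymbol{\mu}(t))+\gamma(t),$$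 with $\boldsymbol{\mu}(t)=\boldsymbol{\mu}_0+t\mathbf{u}_0$, $\sigma(t)=\big((\sigma_0+a_0t)^2+\frac{t^2}{4m^2\sigma_0^2}\big)^{1/2}$, $\gamma(t)=c_0+\frac m2|\mathbf{u}_0|^2t-\frac{d}{4m}\int_0^t\sigma(\tau)^{-2}\,\mathrm{d}\tau$. That is, with $\mathbf{v}^{\theta_0}:=\frac1m\nabla\theta^{\theta_0}$, $X^{\theta_0}$ is the unique solution of $$\partial_tX^{\theta_0}(t;x)=\mathbf{v}^{\theta_0}(X^{\theta_0}(t;x),t)\ \text{ for }(t,x)\in(0,T)\times\mathbb{R}^d,\qquad X^{\theta_0}(0;x)=x\ \text{ for }x\in\mathbb{R}^d.$$ $\mathcal{P}(\mathbb{R}^d)$ is the set of Borel probability measures on $\mathbb{R}^d$, $\rho_0\,\mathrm{d}x$ is the measure with Lebesgue density $\rho_0$, $F_{\#}\mu$ is the pushforward, and $\mathcal{N}(\boldsymbol{\mu},\sigma^2I_d)$ is the isotropic Gaussian distribution with mean $\boldsymbol{\mu}$ and covariance $\sigma^2I_d$. *)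

theory Defs
  imports "HOL-Probability.Probability"
begin

definition multivariate_normal :: "real ^ 'n \<Rightarrow> real ^ 'n ^ 'n \<Rightarrow> (real ^ 'n) measure" where
  "multivariate_normal \<mu> S =
     density lborel (\<lambda>x. ennreal (exp (- ((x - \<mu>) \<bullet> (matrix_inv S *v (x - \<mu>))) / 2)
                                    / sqrt ((2 * pi) ^ CARD('n) * det S)))"

definition gaussian_density :: "real ^ 'n \<Rightarrow> real \<Rightarrow> real ^ 'n \<Rightarrow> real" where
  "gaussian_density \<mu> \<sigma> x =
     1 / ((2 * pi * \<sigma>\<^sup>2) powr (real CARD('n) / 2)) * exp (- ((norm (x - \<mu>))\<^sup>2 / (2 * \<sigma>\<^sup>2)))"

definition quadratic_phase ::
    "real \<Rightarrow> real \<Rightarrow> real ^ 'n \<Rightarrow> real \<Rightarrow> real ^ 'n \<Rightarrow> real \<Rightarrow> real ^ 'n \<Rightarrow> real" where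
  "quadratic_phase m \<sigma>0 \<mu>0 a0 u0 c0 x =
     m * a0 / (2 * \<sigma>0) * (norm (x - \<mu>0))\<^sup>2 + m * (u0 \<bullet> (x - \<mu>0)) + c0"

definition gauss_mean :: "real ^ 'n \<Rightarrow> real ^ 'n \<Rightarrow> real \<Rightarrow> real ^ 'n" where
  "gauss_mean \<mu>0 u0 t = \<mu>0 + t *\<^sub>R u0"

definition gauss_width :: "real \<Rightarrow> real \<Rightarrow> real \<Rightarrow> real \<Rightarrow> real" where
  "gauss_width m \<sigma>0 a0 t = sqrt ((\<sigma>0 + a0 * t)\<^sup>2 + t\<^sup>2 / (4 * m\<^sup>2 * \<sigma>0\<^sup>2))"

definition gauss_gamma :: "real \<Rightarrow> real \<Rightarrow> real \<Rightarrow> real ^ 'n \<Rightarrow> real \<Rightarrow> real \<Rightarrow> real" where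
  "gauss_gamma m \<sigma>0 a0 u0 c0 t =
     c0 + m / 2 * (norm u0)\<^sup>2 * t
        - real CARD('n) / (4 * m) * integral {0..t} (\<lambda>\<tau>. 1 / (gauss_width m \<sigma>0 a0 \<tau>)\<^sup>2)"

definition gauss_rho ::
    "real \<Rightarrow> real \<Rightarrow> real ^ 'n \<Rightarrow> real \<Rightarrow> real ^ 'n \<Rightarrow> real ^ 'n \<Rightarrow> real \<Rightarrow> real" where
  "gauss_rho m \<sigma>0 \<mu>0 a0 u0 x t =
     gaussian_density (gauss_mean \<mu>0 u0 t) (gauss_width m \<sigma>0 a0 t) x"

definition gauss_theta ::
    "real \<Rightarrow> real \<Rightarrow> real ^ 'n \<Rightarrow> real \<Rightarrow> real ^ 'n \<Rightarrow> real \<Rightarrow> real ^ 'n \<Rightarrow> real \<Rightarrow> real" where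
  "gauss_theta m \<sigma>0 \<mu>0 a0 u0 c0 x t =
     m * deriv (gauss_width m \<sigma>0 a0) t / (2 * gauss_width m \<sigma>0 a0 t)
         * (norm (x - gauss_mean \<mu>0 u0 t))\<^sup>2
       + m * (u0 \<bullet> (x - gauss_mean \<mu>0 u0 t)) + gauss_gamma m \<sigma>0 a0 u0 c0 t"

text \<open>
  The Gaussian solution (density, phase) of the free Madelung problem (units with reduced Planck
  constant 1) whose initial density is \<^term>\<open>gaussian_density \<mu>0 \<sigma>0\<close> and whose initial phase is the
  function \<^term>\<open>\<theta>0\<close>. It is given by its closed form. The parameters \<^term>\<open>a0\<close>,
  \<^term>\<open>u0\<close>, \<^term>\<open>c0\<close> are read off from \<^term>\<open>\<theta>0\<close>, which determines them
  (\<open>quadratic_phase_inject\<close> and \<open>gaussian_solution_eq\<close> below).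
\<close>

definition gaussian_solution ::
    "real \<Rightarrow> real \<Rightarrow> real ^ 'n \<Rightarrow> (real ^ 'n \<Rightarrow> real)
      \<Rightarrow> (real ^ 'n \<Rightarrow> real \<Rightarrow> real) \<times> (real ^ 'n \<Rightarrow> real \<Rightarrow> real)" where
  "gaussian_solution m \<sigma>0 \<mu>0 \<theta>0 =
     (THE s. \<exists>a0 u0 c0. \<theta>0 = quadratic_phase m \<sigma>0 \<mu>0 a0 u0 c0 \<and>
               s = (gauss_rho m \<sigma>0 \<mu>0 a0 u0, gauss_theta m \<sigma>0 \<mu>0 a0 u0 c0))"

lemma quadratic_phase_inject:
  fixes \<mu>0 u u' :: "real ^ 'n"
  assumes "m > 0" "\<sigma>0 > 0"
    and eq: "quadratic_phase m \<sigma>0 \<mu>0 a u c = quadratic_phase m \<sigma>0 \<mu>0 a' u' c'"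
  shows "a = a' \<and> u = u' \<and> c = c'"
proof -
  have E: "m * a / (2 * \<sigma>0) * (norm y)\<^sup>2 + m * (u \<bullet> y) + c
         = m * a' / (2 * \<sigma>0) * (norm y)\<^sup>2 + m * (u' \<bullet> y) + c'" for y
    using fun_cong[OF eq, of "\<mu>0 + y"] by (simp add: quadratic_phase_def)
  have c: "c = c'" using E[of 0] by simp
  have "u \<bullet> y = u' \<bullet> y" for y
  proof -
    have "2 * (m * (u \<bullet> y)) = 2 * (m * (u' \<bullet> y))"
      using E[of y] E[of "- y"] unfolding norm_minus_cancel inner_minus_right mult_minus_right
      by linarith
    then show ?thesis using assms by simp
  qed
  then have u: "u = u'" by (metis vector_eq_rdot)
  obtain b :: "real ^ 'n" where "b \<in> Basis" using nonempty_Basis by blast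
  then have "a = a'" using E[of b] assms c u by (simp add: field_simps)
  with c u show ?thesis by simp
qed

lemma gaussian_solution_eq:
  assumes "m > 0" "\<sigma>0 > 0"
  shows "gaussian_solution m \<sigma>0 \<mu>0 (quadratic_phase m \<sigma>0 \<mu>0 a0 u0 c0)
           = (gauss_rho m \<sigma>0 \<mu>0 a0 u0, gauss_theta m \<sigma>0 \<mu>0 a0 u0 c0)"
  unfolding gaussian_solution_def
  by (rule the_equality) (use quadratic_phase_inject[OF assms] in blast)+

definition gradient :: "('a::real_inner \<Rightarrow> real) \<Rightarrow> 'a \<Rightarrow> 'a" where
  "gradient f x = (THE D. GDERIV f x :> D)"

definition velocity :: "real \<Rightarrow> ('a::real_inner \<Rightarrow> real \<Rightarrow> real) \<Rightarrow> 'a \<Rightarrow> real \<Rightarrow> 'a" where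
  "velocity m \<theta> x t = (1 / m) *\<^sub>R gradient (\<lambda>y. \<theta> y t) x"

text \<open>
  A flow is a function on \<open>[0,T]\<close>, represented extensionally (so that uniqueness is meaningful).
  The differential equation is imposed on the open interval only; continuity on the closed
  interval ties the values at times \<open>0\<close> and \<open>T\<close> to it.
\<close>

definition is_flow ::
    "real \<Rightarrow> ('a::real_normed_vector \<Rightarrow> real \<Rightarrow> 'a) \<Rightarrow> (real \<Rightarrow> 'a \<Rightarrow> 'a) \<Rightarrow> bool" where
  "is_flow T v X \<longleftrightarrow>
     X \<in> extensional {0..T} \<and>
     (\<forall>x. X 0 x = x) \<and>
     (\<forall>x. continuous_on {0..T} (\<lambda>t. X t x)) \<and>
     (\<forall>x. \<forall>t\<in>{0<..<T}. ((\<lambda>s. X s x) has_vector_derivative v (X t x) t) (at t))"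

definition characteristic_flow ::
    "real \<Rightarrow> real \<Rightarrow> real \<Rightarrow> real ^ 'n \<Rightarrow> (real ^ 'n \<Rightarrow> real) \<Rightarrow> real \<Rightarrow> real ^ 'n \<Rightarrow> real ^ 'n" where
  "characteristic_flow m T \<sigma>0 \<mu>0 \<theta>0 =
     (THE X. is_flow T (velocity m (snd (gaussian_solution m \<sigma>0 \<mu>0 \<theta>0))) X)"

definition terminal_map :: "real \<Rightarrow> real ^ 'n \<Rightarrow> real \<Rightarrow> real ^ 'n \<Rightarrow> real ^ 'n \<Rightarrow> real ^ 'n" where
  "terminal_map \<sigma>0 \<mu>0 \<sigma>s \<mu>s x = \<mu>s + (\<sigma>s / \<sigma>0) *\<^sub>R (x - \<mu>0)"

end

theory Submission
  imports Defs
begin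

text \<open>
  The velocity field is affine in space, namely the derivative of the width divided by the width,
  times the displacement from the mean, plus the constant drift. Hence along each trajectory the
  standardised displacement \<open>(X t x - \<mu> t) / \<sigma> t\<close> is constant, and the flow is
  \<open>\<mu> t + (\<sigma> t / \<sigma>0) (x - \<mu>0)\<close>. The two values of the slope are the roots of the quadratic
  equation \<open>\<sigma> T = \<sigma>s\<close>, which is solvable exactly when \<open>\<sigma>s \<ge> T / (2 m \<sigma>0)\<close>.
\<close>

section \<open>Flows of affine velocity fields\<close>

lemma is_flow_affine_field_iff:
  fixes s s' :: "real \<Rightarrow> real" and \<mu> u :: "real \<Rightarrow> 'a::euclidean_space"
  assumes T: "T \<ge> 0"
    and s0: "\<And>t. t \<in> {0..T} \<Longrightarrow> s t \<noteq> 0"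
    and cs: "continuous_on {0..T} s" and c\<mu>: "continuous_on {0..T} \<mu>"
    and ds: "\<And>t. t \<in> {0<..<T} \<Longrightarrow> (s has_real_derivative s' t) (at t)"
    and d\<mu>: "\<And>t. t \<in> {0<..<T} \<Longrightarrow> (\<mu> has_vector_derivative u t) (at t)"
  shows "is_flow T (\<lambda>x t. (s' t / s t) *\<^sub>R (x - \<mu> t) + u t) X \<longleftrightarrow>
    X = restrict (\<lambda>t x. \<mu> t + (s t / s 0) *\<^sub>R (x - \<mu> 0)) {0..T}" (is "_ \<longleftrightarrow> X = ?Y")
proof
  assume X: "is_flow T (\<lambda>x t. (s' t / s t) *\<^sub>R (x - \<mu> t) + u t) X"
  have "X t x = \<mu> t + (s t / s 0) *\<^sub>R (x - \<mu> 0)" if t: "t \<in> {0..T}" for t x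
  proof -
    define Z where "Z = (\<lambda>t. (1 / s t) *\<^sub>R (X t x - \<mu> t))"
    have "continuous_on {0..T} (\<lambda>t. X t x)" using X by (auto simp: is_flow_def)
    then have cZ: "continuous_on {0..T} Z"
      unfolding Z_def using s0 by (intro continuous_intros cs c\<mu>) auto
    \<comment> \<open>The differential equation holds on the open interval only, so the endpoints
      form a finite exceptional set, which \<open>cZ\<close> bridges.\<close>
    have dZ: "(Z has_derivative (\<lambda>h. 0)) (at r within {0..T})" if "r \<in> {0..T} - {0, T}" for r
    proof -
      have r: "r \<in> {0<..<T}" "s r \<noteq> 0" using that s0 by auto
      have "((\<lambda>t. X t x) has_vector_derivative (s' r / s r) *\<^sub>R (X r x - \<mu> r) + u r) (at r)"
        using X r by (auto simp: is_flow_def)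
      from has_vector_derivative_diff[OF this d\<mu>[OF r(1)]]
      have dX: "((\<lambda>t. X t x - \<mu> t) has_vector_derivative (s' r / s r) *\<^sub>R (X r x - \<mu> r)) (at r)"
        by simp
      \<comment> \<open>In the product rule the derivative of \<open>1 / s\<close> exactly cancels
        the linear growth at rate \<open>s' r / s r\<close> found in \<open>dX\<close>.\<close>
      have "((\<lambda>t. 1 / s t) has_real_derivative - (s' r / (s r * s r))) (at r)"
        using r(2) by (auto intro!: derivative_eq_intros ds[OF r(1)])
      from has_vector_derivative_scaleR[OF this dX]
      have "(Z has_vector_derivative 0) (at r)"
        unfolding Z_def by simp
      then show ?thesis
        unfolding has_vector_derivative_def by (simp add: has_derivative_at_withinI)
    qed
    have "Z t = Z 0"
      by (rule has_derivative_zero_unique_strong_interval[of "{0, T}", OF _ cZ refl dZ t]) auto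
    then have "s t *\<^sub>R Z t = s t *\<^sub>R Z 0" by simp
    moreover have "X 0 x = x" using X by (auto simp: is_flow_def)
    ultimately show ?thesis using s0[OF t] by (simp add: Z_def algebra_simps)
  qed
  moreover have "X \<in> extensional {0..T}" using X by (auto simp: is_flow_def)
  \<comment> \<open>Outside \<open>{0..T}\<close> both sides are \<open>undefined\<close> by
    extensionality.\<close>
  ultimately show "X = ?Y"
    by (auto simp: fun_eq_iff restrict_def extensional_def)
next
  assume X: "X = ?Y"
  have "s 0 \<noteq> 0" using s0 T by auto
  have "((\<lambda>t. ?Y t x) has_vector_derivative (s' t / s t) *\<^sub>R (?Y t x - \<mu> t) + u t) (at t)"
    if t: "t \<in> {0<..<T}" for t x
  proof -
    have "s t \<noteq> 0" using t s0 by auto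
    have "((\<lambda>t. s t / s 0) has_real_derivative s' t / s 0) (at t)"
      by (intro DERIV_cdivide ds t)
    then have "((\<lambda>t. \<mu> t + (s t / s 0) *\<^sub>R (x - \<mu> 0)) has_vector_derivative
        u t + ((s t / s 0) *\<^sub>R 0 + (s' t / s 0) *\<^sub>R (x - \<mu> 0))) (at t)"
      by (intro has_vector_derivative_add d\<mu> t has_vector_derivative_scaleR
          has_vector_derivative_const)
    moreover have "u t + ((s t / s 0) *\<^sub>R 0 + (s' t / s 0) *\<^sub>R (x - \<mu> 0)) =
        (s' t / s t) *\<^sub>R (?Y t x - \<mu> t) + u t"
      using t \<open>s t \<noteq> 0\<close> by simp
    ultimately have "((\<lambda>t. \<mu> t + (s t / s 0) *\<^sub>R (x - \<mu> 0)) has_vector_derivative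
        (s' t / s t) *\<^sub>R (?Y t x - \<mu> t) + u t) (at t)"
      by metis
    \<comment> \<open>The restriction \<open>?Y\<close> agrees with the closed formula on the open
      interval, a neighbourhood of \<open>t\<close>, so the derivative carries over.\<close>
    then show ?thesis
      by (rule has_vector_derivative_transform_within_open[OF _ open_greaterThanLessThan t]) simp
  qed
  moreover have "continuous_on {0..T} (\<lambda>t. ?Y t x)" for x
  proof -
    have "continuous_on {0..T} (\<lambda>t. \<mu> t + (s t / s 0) *\<^sub>R (x - \<mu> 0))"
      using \<open>s 0 \<noteq> 0\<close> by (intro continuous_intros cs c\<mu>) auto
    then show ?thesis by (rule continuous_on_eq) simp
  qed
  ultimately show "is_flow T (\<lambda>x t. (s' t / s t) *\<^sub>R (x - \<mu> t) + u t) X"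
    unfolding X is_flow_def using T \<open>s 0 \<noteq> 0\<close> by simp
qed

section \<open>Gradient, Gaussian width and closed form of the characteristic flow\<close>

lemma gradient_eqI:
  assumes "GDERIV f x :> D"
  shows "gradient f x = D"
  unfolding gradient_def
proof (rule the_equality)
  fix E assume "GDERIV f x :> E"
  with assms have "(\<lambda>h. h \<bullet> E) = (\<lambda>h. h \<bullet> D)"
    unfolding gderiv_def by (rule has_derivative_unique[rotated])
  then show "E = D" by (metis vector_eq_ldot)
qed fact

lemma gradient_quadratic:
  "gradient (\<lambda>x. k * (norm (x - \<mu>))\<^sup>2 + m * (u \<bullet> (x - \<mu>)) + c) x
    = (2 * k) *\<^sub>R (x - \<mu>) + m *\<^sub>R u"
  by (rule gradient_eqI)
     (auto simp: gderiv_def power2_norm_eq_inner algebra_simps inner_commute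
       intro!: derivative_eq_intros)

text \<open>For negative \<open>a0\<close> the first square vanishes at some positive time, where
  the dispersive term is positive; at time 0 the first square is
  \<open>\<sigma>0\<^sup>2\<close>.\<close>

lemma gauss_width_radicand_pos:
  fixes m \<sigma>0 a0 t :: real
  assumes "m > 0" "\<sigma>0 > 0"
  shows "(\<sigma>0 + a0 * t)\<^sup>2 + t\<^sup>2 / (4 * m\<^sup>2 * \<sigma>0\<^sup>2) > 0"
proof (cases "t = 0")
  case False
  then have "t\<^sup>2 / (4 * m\<^sup>2 * \<sigma>0\<^sup>2) > 0" using assms by simp
  then show ?thesis by (simp add: add_nonneg_pos)
qed (use assms in simp)

lemma gauss_width_pos:
  "m > 0 \<Longrightarrow> \<sigma>0 > 0 \<Longrightarrow> gauss_width m \<sigma>0 a0 t > 0"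
  by (simp add: gauss_width_def gauss_width_radicand_pos)

text \<open>The square root is differentiable because its radicand never vanishes. The derivative
  stays in the form \<open>deriv\<close>, as it occurs in \<open>gauss_theta\<close>.\<close>

lemma gauss_width_DERIV:
  assumes "m > 0" "\<sigma>0 > 0"
  shows "(gauss_width m \<sigma>0 a0 has_real_derivative deriv (gauss_width m \<sigma>0 a0) t) (at t)"
proof -
  let ?q = "\<lambda>t. (\<sigma>0 + a0 * t)\<^sup>2 + t\<^sup>2 / (4 * m\<^sup>2 * \<sigma>0\<^sup>2)"
  have dq: "(?q has_real_derivative 2 * (\<sigma>0 + a0 * t) * a0 + 2 * t / (4 * m\<^sup>2 * \<sigma>0\<^sup>2)) (at t)"
    by (intro DERIV_add DERIV_cdivide) (auto intro!: derivative_eq_intros)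
  have "?q t > 0"
    by (rule gauss_width_radicand_pos[OF assms])
  from DERIV_chain2[where f = sqrt and g = ?q, OF DERIV_real_sqrt[OF this] dq]
  show ?thesis
    unfolding DERIV_deriv_iff_field_differentiable field_differentiable_def gauss_width_def[abs_def]
    by (rule exI)
qed

lemma velocity_gauss_theta:
  assumes "m > 0"
  shows "velocity m (gauss_theta m \<sigma>0 \<mu>0 a0 u0 c0) = (\<lambda>x t.
    (deriv (gauss_width m \<sigma>0 a0) t / gauss_width m \<sigma>0 a0 t) *\<^sub>R (x - gauss_mean \<mu>0 u0 t) + u0)"
  unfolding velocity_def gauss_theta_def gradient_quadratic
  using assms by (simp add: fun_eq_iff scaleR_add_right)

text \<open>The equivalence for affine fields contains both existence and uniqueness, so the
  description by \<open>THE\<close> collapses to the explicit flow.\<close>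

lemma characteristic_flow_eq:
  assumes "m > 0" "T \<ge> 0" "\<sigma>0 > 0"
  shows "characteristic_flow m T \<sigma>0 \<mu>0 (quadratic_phase m \<sigma>0 \<mu>0 a0 u0 c0) =
    restrict (\<lambda>t x. gauss_mean \<mu>0 u0 t + (gauss_width m \<sigma>0 a0 t / \<sigma>0) *\<^sub>R (x - \<mu>0)) {0..T}"
proof -
  let ?s = "gauss_width m \<sigma>0 a0" and ?\<mu> = "gauss_mean \<mu>0 u0"
  have "?s 0 = \<sigma>0" "?\<mu> 0 = \<mu>0"
    using assms by (simp_all add: gauss_width_def gauss_mean_def)
  moreover have "is_flow T (\<lambda>x t. (deriv ?s t / ?s t) *\<^sub>R (x - ?\<mu> t) + u0) X \<longleftrightarrow>
    X = restrict (\<lambda>t x. ?\<mu> t + (?s t / ?s 0) *\<^sub>R (x - ?\<mu> 0)) {0..T}" for X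
  proof (rule is_flow_affine_field_iff)
    show "?s t \<noteq> 0" for t using gauss_width_pos assms by (metis less_irrefl)
    show "continuous_on {0..T} ?s"
      using gauss_width_DERIV[OF assms(1,3)]
      by (intro continuous_at_imp_continuous_on) (blast intro: DERIV_isCont)
    show "continuous_on {0..T} ?\<mu>"
      unfolding gauss_mean_def by (intro continuous_intros)
    show "(?\<mu> has_vector_derivative u0) (at t)" for t
      unfolding gauss_mean_def by (auto intro!: derivative_eq_intros)
  qed (use assms gauss_width_DERIV in auto)
  ultimately show ?thesis
    using assms by (simp add: characteristic_flow_def gaussian_solution_eq velocity_gauss_theta)
qed

lemma gauss_width_terminal:
  fixes m T \<sigma>0 \<sigma>s :: real
  assumes "m > 0" "T > 0" "\<sigma>0 > 0" "\<sigma>s > 0" "\<sigma>s \<ge> T / (2 * m * \<sigma>0)"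
    and a0: "a0 \<in> {1 / T * (- \<sigma>0 + sqrt (\<sigma>s\<^sup>2 - T\<^sup>2 / (4 * m\<^sup>2 * \<sigma>0\<^sup>2))),
                   1 / T * (- \<sigma>0 - sqrt (\<sigma>s\<^sup>2 - T\<^sup>2 / (4 * m\<^sup>2 * \<sigma>0\<^sup>2)))}"
  shows "gauss_width m \<sigma>0 a0 T = \<sigma>s"
proof -
  let ?D = "\<sigma>s\<^sup>2 - T\<^sup>2 / (4 * m\<^sup>2 * \<sigma>0\<^sup>2)"
  \<comment> \<open>Squaring the lower bound on \<open>\<sigma>s\<close> makes \<open>?D\<close>
    nonnegative, so \<open>sqrt ?D\<close> squares back to \<open>?D\<close>. The sign separating
    the two slopes disappears in the same squaring.\<close>
  have "(T / (2 * m * \<sigma>0))\<^sup>2 \<le> \<sigma>s\<^sup>2"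
    using assms by (intro power_mono) auto
  then have "?D \<ge> 0" by (simp add: power_divide power_mult_distrib)
  moreover have "\<sigma>0 + a0 * T = sqrt ?D \<or> \<sigma>0 + a0 * T = - sqrt ?D"
    using a0 \<open>T > 0\<close> by auto
  ultimately have "(\<sigma>0 + a0 * T)\<^sup>2 = ?D" by auto
  then show ?thesis
    unfolding gauss_width_def using \<open>\<sigma>s > 0\<close> by simp
qed

section \<open>Isotropic Gaussian measures and their affine images\<close>

lemma matrix_inv_scaleR_mat_1:
  fixes k :: real
  assumes "k \<noteq> 0"
  shows "matrix_inv (k *\<^sub>R mat 1 :: real ^ 'n ^ 'n) = (1 / k) *\<^sub>R mat 1"
proof -
  let ?A = "k *\<^sub>R mat 1 :: real ^ 'n ^ 'n" and ?B = "(1 / k) *\<^sub>R mat 1 :: real ^ 'n ^ 'n"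
  have AB: "?A ** ?B = mat 1" "?B ** ?A = mat 1"
    using assms by (simp_all add: matrix_eq scaleR_matrix_vector_assoc[symmetric]
        matrix_vector_mul_assoc[symmetric] matrix_vector_mult_scaleR)
  \<comment> \<open>\<open>matrix_inv\<close> is a \<open>SOME\<close> choice: the witness
    \<open>?B\<close> shows that the chosen matrix is a two-sided inverse, and uniqueness of
    inverses then identifies it with \<open>?B\<close>.\<close>
  have "?A ** matrix_inv ?A = mat 1 \<and> matrix_inv ?A ** ?A = mat 1"
    unfolding matrix_inv_def
    by (rule someI[where P = "\<lambda>X. ?A ** X = mat 1 \<and> X ** ?A = mat 1" and x = ?B]) (simp only: AB simp_thms)
  then have "?B = ?B ** (?A ** matrix_inv ?A)" by simp
  also have "\<dots> = matrix_inv ?A" unfolding matrix_mul_assoc AB by simp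
  finally show ?thesis ..
qed

lemma det_scaleR_mat_1:
  "det (k *\<^sub>R mat 1 :: real ^ 'n ^ 'n) = k ^ CARD('n)"
  by (subst det_diagonal) (auto simp: mat_def)

lemma multivariate_normal_isotropic:
  fixes \<mu> :: "real ^ 'n"
  assumes "\<sigma> > 0"
  shows "multivariate_normal \<mu> (\<sigma>\<^sup>2 *\<^sub>R mat 1) =
    density lborel (\<lambda>x. ennreal (gaussian_density \<mu> \<sigma> x))"
proof -
  \<comment> \<open>Reconciles the two normalisations: a real power with exponent n/2 against the
    square root of a natural power times the determinant.\<close>
  have "(2 * pi * \<sigma>\<^sup>2) powr (real CARD('n) / 2) = sqrt ((2 * pi) ^ CARD('n) * (\<sigma>\<^sup>2) ^ CARD('n))"
    using assms by (simp add: powr_half_sqrt_powr powr_realpow power_mult_distrib)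
  then show ?thesis
    using assms
    by (simp add: mult.commute[of "\<sigma>\<^sup>2" 2] multivariate_normal_def gaussian_density_def matrix_inv_scaleR_mat_1
        det_scaleR_mat_1 scaleR_matrix_vector_assoc[symmetric] power2_norm_eq_inner)
qed

lemma gaussian_density_measurable [measurable]: "gaussian_density \<mu> \<sigma> \<in> borel_measurable borel"
  unfolding gaussian_density_def by measurable

text \<open>Change of variables: Lebesgue measure is \<open>c ^ DIM('a)\<close> times its image
  under the affine map, and this Jacobian is moved into the source density.\<close>

lemma distr_density_lborel_affine:
  fixes t :: "'a::euclidean_space" and g :: "'a \<Rightarrow> ennreal"
  assumes "c > 0" and [measurable]: "g \<in> borel_measurable borel"
  shows "distr (density lborel (\<lambda>x. ennreal (c ^ DIM('a)) * g (t + c *\<^sub>R x))) borel (\<lambda>x. t + c *\<^sub>R x)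
    = density lborel g"
proof -
  have "density lborel g =
      density (density (distr lborel borel (\<lambda>x. t + c *\<^sub>R x)) (\<lambda>_. ennreal (\<bar>c\<bar> ^ DIM('a)))) g"
    using assms(1) by (subst lborel_affine[of c t]) auto
  also have "\<dots> = density (distr lborel borel (\<lambda>x. t + c *\<^sub>R x)) (\<lambda>x. ennreal (c ^ DIM('a)) * g x)"
    using assms(1) by (subst density_density_eq) auto
  also have "\<dots> = distr (density lborel (\<lambda>x. ennreal (c ^ DIM('a)) * g (t + c *\<^sub>R x))) borel
      (\<lambda>x. t + c *\<^sub>R x)"
    by (subst density_distr) auto
  finally show ?thesis ..
qed

text \<open>The Jacobian equation of the transport. The map preserves the standardised displacement,
  so the exponents agree, and its Jacobian is the ratio of the normalising constants.\<close>

lemma gaussian_density_terminal_map: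
  fixes x :: "real ^ 'n"
  assumes "\<sigma>0 > 0" "\<sigma>s > 0"
  shows "(\<sigma>s / \<sigma>0) ^ CARD('n) * gaussian_density \<mu>s \<sigma>s (terminal_map \<sigma>0 \<mu>0 \<sigma>s \<mu>s x)
    = gaussian_density \<mu>0 \<sigma>0 x"
proof -
  have "(2 * pi * \<sigma>\<^sup>2) powr (real CARD('n) / 2) = sqrt ((2 * pi) ^ CARD('n)) * \<sigma> ^ CARD('n)"
    if "\<sigma> > 0" for \<sigma> :: real
    using that by (simp add: powr_half_sqrt_powr powr_realpow power_mult_distrib real_sqrt_mult
        real_sqrt_power)
  moreover have "(norm (terminal_map \<sigma>0 \<mu>0 \<sigma>s \<mu>s x - \<mu>s))\<^sup>2 / (2 * \<sigma>s\<^sup>2) =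
      (norm (x - \<mu>0))\<^sup>2 / (2 * \<sigma>0\<^sup>2)"
    using assms by (simp add: terminal_map_def power_mult_distrib power_divide)
  ultimately show ?thesis
    using assms by (simp add: gaussian_density_def power_divide)
qed

lemma distr_gaussian_terminal_map:
  fixes \<mu>0 \<mu>s :: "real ^ 'n"
  assumes "\<sigma>0 > 0" "\<sigma>s > 0"
  shows "distr (density lborel (\<lambda>x. ennreal (gaussian_density \<mu>0 \<sigma>0 x))) borel (terminal_map \<sigma>0 \<mu>0 \<sigma>s \<mu>s)
    = density lborel (\<lambda>x. ennreal (gaussian_density \<mu>s \<sigma>s x))"
proof -
  let ?c = "\<sigma>s / \<sigma>0"
  \<comment> \<open>Puts the map into the form of a dilation followed by a translation, as the
    change of variables requires.\<close>
  have X: "terminal_map \<sigma>0 \<mu>0 \<sigma>s \<mu>s = (\<lambda>x. (\<mu>s - ?c *\<^sub>R \<mu>0) + ?c *\<^sub>R x)"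
    by (auto simp: terminal_map_def fun_eq_iff algebra_simps)
  have "ennreal (gaussian_density \<mu>0 \<sigma>0 x) = ennreal (?c ^ DIM(real ^ 'n)) *
      ennreal (gaussian_density \<mu>s \<sigma>s ((\<mu>s - ?c *\<^sub>R \<mu>0) + ?c *\<^sub>R x))" for x
    using assms gaussian_density_terminal_map[OF assms, of \<mu>s \<mu>0 x]
    by (simp add: X flip: ennreal_mult')
  then show ?thesis
    using assms by (simp only: X) (intro distr_density_lborel_affine, auto)
qed

theorem corollary3p3:
  fixes m T \<sigma>0 \<sigma>s :: real and \<mu>0 \<mu>s :: "real ^ 'n"
  assumes "m > 0" and "T > 0" and "\<sigma>0 > 0" and "\<sigma>s > 0"
    and "\<sigma>s \<ge> T / (2 * m * \<sigma>0)"
  shows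
    "(\<forall>a0 c0 :: real.
        a0 \<in> {1 / T * (- \<sigma>0 + sqrt (\<sigma>s\<^sup>2 - T\<^sup>2 / (4 * m\<^sup>2 * \<sigma>0\<^sup>2))),
              1 / T * (- \<sigma>0 - sqrt (\<sigma>s\<^sup>2 - T\<^sup>2 / (4 * m\<^sup>2 * \<sigma>0\<^sup>2)))} \<longrightarrow>
        (\<forall>x. characteristic_flow m T \<sigma>0 \<mu>0
               (quadratic_phase m \<sigma>0 \<mu>0 a0 ((1 / T) *\<^sub>R (\<mu>s - \<mu>0)) c0) T x
             = terminal_map \<sigma>0 \<mu>0 \<sigma>s \<mu>s x)) \<and>
     (\<forall>(M :: 'b measure) X0.
        prob_space M \<and> X0 \<in> borel_measurable M \<and>
        distr M borel X0 = density lborel (\<lambda>x. ennreal (gaussian_density \<mu>0 \<sigma>0 x)) \<longrightarrow>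
        distr M borel (\<lambda>\<xi>. terminal_map \<sigma>0 \<mu>0 \<sigma>s \<mu>s (X0 \<xi>))
          = multivariate_normal \<mu>s (\<sigma>s\<^sup>2 *\<^sub>R mat 1))"
proof (intro conjI allI impI)
  fix a0 c0 :: real and x :: "real ^ 'n"
  assume "a0 \<in> {1 / T * (- \<sigma>0 + sqrt (\<sigma>s\<^sup>2 - T\<^sup>2 / (4 * m\<^sup>2 * \<sigma>0\<^sup>2))),
              1 / T * (- \<sigma>0 - sqrt (\<sigma>s\<^sup>2 - T\<^sup>2 / (4 * m\<^sup>2 * \<sigma>0\<^sup>2)))}"
  from gauss_width_terminal[OF assms this]
  show "characteristic_flow m T \<sigma>0 \<mu>0
               (quadratic_phase m \<sigma>0 \<mu>0 a0 ((1 / T) *\<^sub>R (\<mu>s - \<mu>0)) c0) T x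
             = terminal_map \<sigma>0 \<mu>0 \<sigma>s \<mu>s x"
    \<comment> \<open>At time \<open>T\<close> the width is \<open>\<sigma>s\<close>, and the drift
      \<open>(1 / T) *\<^sub>R (\<mu>s - \<mu>0)\<close> has carried the mean to
      \<open>\<mu>s\<close>.\<close>
    using assms by (simp add: characteristic_flow_eq terminal_map_def gauss_mean_def)
next
  fix M :: "'b measure" and X0 :: "'b \<Rightarrow> real ^ 'n"
  assume *: "prob_space M \<and> X0 \<in> borel_measurable M \<and>
        distr M borel X0 = density lborel (\<lambda>x. ennreal (gaussian_density \<mu>0 \<sigma>0 x))"
  have "terminal_map \<sigma>0 \<mu>0 \<sigma>s \<mu>s \<in> borel_measurable borel"
    unfolding terminal_map_def by measurable
  \<comment> \<open>Only the law of \<open>X0\<close> enters, which reduces the claim to the image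
    of one Gaussian measure.\<close>
  then have "distr M borel (\<lambda>\<xi>. terminal_map \<sigma>0 \<mu>0 \<sigma>s \<mu>s (X0 \<xi>))
      = distr (distr M borel X0) borel (terminal_map \<sigma>0 \<mu>0 \<sigma>s \<mu>s)"
    using * by (subst distr_distr) (auto simp: comp_def)
  then show "distr M borel (\<lambda>\<xi>. terminal_map \<sigma>0 \<mu>0 \<sigma>s \<mu>s (X0 \<xi>))
      = multivariate_normal \<mu>s (\<sigma>s\<^sup>2 *\<^sub>R mat 1)"
    using * assms by (simp add: distr_gaussian_terminal_map multivariate_normal_isotropic)
qed

end
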